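(* Let $L \subseteq \Delta^{n}$ be a finite simplicial complex, and let $S$ be a subset of the vertices of $L$ such that every element of $S$ is a source or a sink of $L$. Let $L(-S)$ be the subcomplex of $L$ consisting of the simplices which do not have a vertex in $S$. Then $L(-S)$ is a full subcomplex of $L$.
   Context: A finite simplicial complex is a subcomplex (simplicial subset) $L \subseteq \Delta^{n}$ of a standard simplex; its vertices inherit the total order of $\{0,1,\dots,n\}$, and $1$-simplices are written $v \to w$ (so $v \le w$, with $v<w$ when the $1$-simplex is non-degenerate). A path in $L$ from $v$ to $v'$ is a string of $1$-simplices $v=v_{0}\to v_{1}\to\dots\to v_{k}=v'$ of $L$. A vertex $v$ of $L$ is a source if there are no non-degenerate $1$-simplices $u \to v$ in $L$; a vertex $z$ is a sink if there are no non-degenerate $1$-simplices $z \to w$ in $L$. A subcomplex $L_{0} \subseteq L$ is a full subcomplex if: (1) whenever $v=v_{0} \to v_{1} \to \dots \to v_{k}=v'$ is a path in $L$ between vertices $v,v'$ of $L_{0}$, all $v_{i}$ are in $L_{0}$; and (2) if all the vertices of a simplex $\sigma$ of $L$ are in $L_{0}$, then $\sigma$ is in $L_{0}$. *)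

theory Defs
  imports Main
begin

text \<open>
  An \<open>m\<close>-simplex of \<open>\<Delta>\<^sup>n\<close>, i.e. a monotone map \<open>[m] \<rightarrow> [n]\<close>, is encoded as the sorted
  list of its \<open>m + 1\<close> values (repetitions allowed, so degenerate simplices are included).
  The vertex \<open>v\<close> is the \<open>0\<close>-simplex \<open>[v]\<close>, and the \<open>1\<close>-simplex \<open>v \<rightarrow> w\<close> is \<open>[v, w]\<close>;
  the vertices of a simplex \<open>\<sigma>\<close> are the elements of \<open>set \<sigma>\<close>.
\<close>

type_synonym simplex = "nat list"

definition std_simplex :: "nat \<Rightarrow> simplex set" where
  "std_simplex n = {\<sigma>. \<sigma> \<noteq> [] \<and> sorted \<sigma> \<and> set \<sigma> \<subseteq> {0..n}}"

definition sdim :: "simplex \<Rightarrow> nat" where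
  "sdim \<sigma> = length \<sigma> - 1"

definition ordinal_map :: "nat \<Rightarrow> nat \<Rightarrow> (nat \<Rightarrow> nat) \<Rightarrow> bool" where
  "ordinal_map k m \<theta> \<longleftrightarrow> mono_on {0..k} \<theta> \<and> \<theta> ` {0..k} \<subseteq> {0..m}"

text \<open>The simplicial structure: \<open>\<theta> : [k] \<rightarrow> [m]\<close> acts on \<open>\<sigma> : [m] \<rightarrow> [n]\<close> by precomposition.\<close>

definition simp_act :: "nat \<Rightarrow> (nat \<Rightarrow> nat) \<Rightarrow> simplex \<Rightarrow> simplex" where
  "simp_act k \<theta> \<sigma> = map (\<lambda>i. \<sigma> ! \<theta> i) [0..<Suc k]"

definition simplicial_subset :: "nat \<Rightarrow> simplex set \<Rightarrow> bool" where
  "simplicial_subset n L \<longleftrightarrow> L \<subseteq> std_simplex n \<and>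
     (\<forall>\<sigma>\<in>L. \<forall>k \<theta>. ordinal_map k (sdim \<sigma>) \<theta> \<longrightarrow> simp_act k \<theta> \<sigma> \<in> L)"

definition degenerate :: "simplex set \<Rightarrow> simplex \<Rightarrow> bool" where
  "degenerate L \<sigma> \<longleftrightarrow> (\<exists>\<tau>\<in>L. \<exists>\<theta>. sdim \<tau> < sdim \<sigma> \<and> ordinal_map (sdim \<sigma>) (sdim \<tau>) \<theta> \<and>
     \<theta> ` {0..sdim \<sigma>} = {0..sdim \<tau>} \<and> \<sigma> = simp_act (sdim \<sigma>) \<theta> \<tau>)"

definition vertices :: "simplex set \<Rightarrow> nat set" where
  "vertices L = {v. [v] \<in> L}"

definition is_source :: "simplex set \<Rightarrow> nat \<Rightarrow> bool" where
  "is_source L v \<longleftrightarrow> v \<in> vertices L \<and> \<not> (\<exists>u. [u, v] \<in> L \<and> \<not> degenerate L [u, v])"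

definition is_sink :: "simplex set \<Rightarrow> nat \<Rightarrow> bool" where
  "is_sink L z \<longleftrightarrow> z \<in> vertices L \<and> \<not> (\<exists>w. [z, w] \<in> L \<and> \<not> degenerate L [z, w])"

text \<open>A path \<open>v\<^sub>0 \<rightarrow> \<dots> \<rightarrow> v\<^sub>k\<close> is the list of its vertices; its edges may be degenerate.\<close>

definition is_path :: "simplex set \<Rightarrow> nat \<Rightarrow> nat list \<Rightarrow> nat \<Rightarrow> bool" where
  "is_path L v vs v' \<longleftrightarrow> vs \<noteq> [] \<and> hd vs = v \<and> last vs = v' \<and> set vs \<subseteq> vertices L \<and>
     (\<forall>i. Suc i < length vs \<longrightarrow> [vs ! i, vs ! Suc i] \<in> L)"

definition full_subcomplex :: "nat \<Rightarrow> simplex set \<Rightarrow> simplex set \<Rightarrow> bool" where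
  "full_subcomplex n L0 L \<longleftrightarrow> simplicial_subset n L \<and> simplicial_subset n L0 \<and> L0 \<subseteq> L \<and>
     (\<forall>v\<in>vertices L0. \<forall>v'\<in>vertices L0. \<forall>vs. is_path L v vs v' \<longrightarrow> set vs \<subseteq> vertices L0) \<and>
     (\<forall>\<sigma>\<in>L. set \<sigma> \<subseteq> vertices L0 \<longrightarrow> \<sigma> \<in> L0)"

definition delete_vertices :: "simplex set \<Rightarrow> nat set \<Rightarrow> simplex set" where
  "delete_vertices L S = {\<sigma> \<in> L. set \<sigma> \<inter> S = {}}"

lemma simplicial_subset_std_simplex: "simplicial_subset n (std_simplex n)"
  unfolding simplicial_subset_def
proof (intro conjI ballI allI impI)
  fix \<sigma> k \<theta> assume s: "\<sigma> \<in> std_simplex n" and o: "ordinal_map k (sdim \<sigma>) \<theta>"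
  have lt: "\<theta> i < length \<sigma>" if "i \<le> k" for i
  proof -
    have "\<theta> i \<le> length \<sigma> - 1" using o that by (force simp: ordinal_map_def sdim_def image_subset_iff)
    moreover have "length \<sigma> > 0" using s by (simp add: std_simplex_def)
    ultimately show ?thesis by linarith
  qed
  have mono: "\<theta> i \<le> \<theta> j" if "i \<le> j" "j \<le> k" for i j
    using o that by (auto simp: ordinal_map_def intro: mono_onD)
  have "sorted (simp_act k \<theta> \<sigma>)"
    using s lt mono unfolding simp_act_def std_simplex_def
    by (auto simp: sorted_iff_nth_mono simp del: upt_Suc)
  moreover have "set (simp_act k \<theta> \<sigma>) \<subseteq> {0..n}"
  proof
    fix x assume "x \<in> set (simp_act k \<theta> \<sigma>)"
    then obtain i where "i \<le> k" "x = \<sigma> ! \<theta> i" by (auto simp: simp_act_def less_Suc_eq_le simp del: upt_Suc)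
    then have "x \<in> set \<sigma>" using lt by simp
    then show "x \<in> {0..n}" using s by (auto simp: std_simplex_def)
  qed
  ultimately show "simp_act k \<theta> \<sigma> \<in> std_simplex n"
    by (simp add: std_simplex_def simp_act_def)
qed simp

lemma degenerate_edge_iff:
  assumes L: "simplicial_subset n L" and e: "[u, v] \<in> L"
  shows "degenerate L [u, v] \<longleftrightarrow> u = v"
proof
  assume "degenerate L [u, v]"
  then obtain \<tau> \<theta> where t: "sdim \<tau> < sdim [u, v]" "ordinal_map (sdim [u, v]) (sdim \<tau>) \<theta>"
    and eq: "[u, v] = simp_act (sdim [u, v]) \<theta> \<tau>"
    unfolding degenerate_def by blast
  have "\<theta> ` {0..1} \<subseteq> {0..0}" using t by (simp add: sdim_def ordinal_map_def)
  then have "\<theta> 0 = 0" "\<theta> 1 = 0" by (auto simp: image_subset_iff)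
  then show "u = v" using eq by (simp add: sdim_def simp_act_def)
next
  assume uv: "u = v"
  have "ordinal_map 0 (sdim [u, v]) (\<lambda>_. 0)" by (simp add: ordinal_map_def mono_on_def)
  then have "simp_act 0 (\<lambda>_. 0) [u, v] \<in> L" using L e unfolding simplicial_subset_def by blast
  then have "[u] \<in> L" by (simp add: simp_act_def)
  then show "degenerate L [u, v]" unfolding degenerate_def
    by (intro bexI[of _ "[u]"] exI[of _ "\<lambda>_. 0"])
       (auto simp: uv sdim_def ordinal_map_def simp_act_def mono_on_def)
qed

end

theory Submission
  imports Defs
begin

text \<open>
  A path can enter a source, or leave a sink, only along degenerate edges. So a path through a
  source starts there, and a path through a sink ends there; a path whose end points avoid \<open>S\<close>
  therefore avoids \<open>S\<close> altogether.
\<close>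

lemma set_simp_act_subset:
  assumes "\<sigma> \<noteq> []" and "ordinal_map k (sdim \<sigma>) \<theta>"
  shows "set (simp_act k \<theta> \<sigma>) \<subseteq> set \<sigma>"
proof
  fix x assume "x \<in> set (simp_act k \<theta> \<sigma>)"
  then obtain i where i: "i \<le> k" "x = \<sigma> ! \<theta> i"
    by (auto simp: simp_act_def less_Suc_eq_le simp del: upt_Suc)
  \<comment> \<open>\<open>sdim\<close> is a truncated subtraction, so non-emptiness of
    \<open>\<sigma>\<close> is what turns this bound into a valid list index.\<close>
  have "\<theta> i \<le> length \<sigma> - 1"
    using assms(2) i(1) by (auto simp: ordinal_map_def sdim_def image_subset_iff)
  moreover have "length \<sigma> > 0" using assms(1) by simp
  ultimately have "\<theta> i < length \<sigma>" by linarith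
  then show "x \<in> set \<sigma>" using i(2) by simp
qed

text \<open>Simplicial operators never add vertices, so a simplex that avoids \<open>S\<close> keeps
  avoiding it.\<close>

lemma simplicial_subset_delete_vertices:
  assumes "simplicial_subset n L"
  shows "simplicial_subset n (delete_vertices L S)"
  unfolding simplicial_subset_def
proof (intro conjI ballI allI impI)
  show "delete_vertices L S \<subseteq> std_simplex n"
    using assms by (auto simp: simplicial_subset_def delete_vertices_def)
next
  fix \<sigma> k \<theta> assume s: "\<sigma> \<in> delete_vertices L S" and o: "ordinal_map k (sdim \<sigma>) \<theta>"
  have "\<sigma> \<in> L" and disj: "set \<sigma> \<inter> S = {}" using s by (auto simp: delete_vertices_def)
  then have "\<sigma> \<noteq> []" and "simp_act k \<theta> \<sigma> \<in> L"
    using assms o by (auto simp: simplicial_subset_def std_simplex_def)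
  with disj o show "simp_act k \<theta> \<sigma> \<in> delete_vertices L S"
    using set_simp_act_subset[of \<sigma> k \<theta>] by (auto simp: delete_vertices_def)
qed

lemma vertices_delete_vertices: "vertices (delete_vertices L S) = vertices L - S"
  by (auto simp: vertices_def delete_vertices_def)

text \<open>An edge of the path into \<open>s\<close> must be degenerate, so the vertex preceding
  \<open>s\<close> is \<open>s\<close> again; going backwards, this reaches index 0.\<close>

lemma path_through_source:
  assumes L: "simplicial_subset n L" and p: "is_path L v vs v'"
    and s: "is_source L s" "s \<in> set vs"
  shows "v = s"
proof -
  have "vs ! i = s \<Longrightarrow> i < length vs \<Longrightarrow> vs ! 0 = s" for i
  proof (induction i)
    case (Suc i)
    have e: "[vs ! i, s] \<in> L" using p Suc.prems by (auto simp: is_path_def)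
    then have "degenerate L [vs ! i, s]" using s(1) by (auto simp: is_source_def)
    then have "vs ! i = s" using degenerate_edge_iff[OF L e] by simp
    then show ?case using Suc by simp
  qed simp
  then show ?thesis using s(2) p by (auto simp: in_set_conv_nth is_path_def hd_conv_nth)
qed

text \<open>Dual to the source case: the value \<open>s\<close> propagates forwards from one
  occurrence to the last index.\<close>

lemma path_through_sink:
  assumes L: "simplicial_subset n L" and p: "is_path L v vs v'"
    and s: "is_sink L s" "s \<in> set vs"
  shows "v' = s"
proof -
  obtain i where i: "i < length vs" "vs ! i = s" using s(2) by (auto simp: in_set_conv_nth)
  have "i \<le> length vs - 1" using i(1) by linarith
  then have "vs ! (length vs - 1) = s"
  proof (induction rule: dec_induct)
    case base
    show ?case by (fact i(2))
  next
    case (step j)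
    have e: "[s, vs ! Suc j] \<in> L" using p step by (auto simp: is_path_def)
    then have "degenerate L [s, vs ! Suc j]" using s(1) by (auto simp: is_sink_def)
    then show ?case using degenerate_edge_iff[OF L e] by simp
  qed
  then show ?thesis using p by (auto simp: is_path_def last_conv_nth)
qed

theorem lemma7:
  fixes n :: nat and L :: "simplex set" and S :: "nat set"
  assumes "simplicial_subset n L"
    and "S \<subseteq> vertices L"
    and "\<forall>s\<in>S. is_source L s \<or> is_sink L s"
  shows "full_subcomplex n (delete_vertices L S) L"
  \<comment> \<open>After this rewriting, both fullness conditions speak of
    \<open>vertices L - S\<close>.\<close>
  unfolding full_subcomplex_def vertices_delete_vertices
proof (intro conjI ballI allI impI)
  show "simplicial_subset n L" by (fact assms(1))
  show "simplicial_subset n (delete_vertices L S)"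
    by (rule simplicial_subset_delete_vertices[OF assms(1)])
  show "delete_vertices L S \<subseteq> L" by (auto simp: delete_vertices_def)
next
  fix v v' vs
  assume v: "v \<in> vertices L - S" "v' \<in> vertices L - S" and p: "is_path L v vs v'"
  \<comment> \<open>A source in \<open>S\<close> on the path would equal \<open>v\<close>, a sink
    would equal \<open>v'\<close>, and neither end point lies in \<open>S\<close>.\<close>
  have "s \<notin> S" if "s \<in> set vs" for s
    using assms(3) v that path_through_source[OF assms(1) p] path_through_sink[OF assms(1) p]
    by blast
  then show "set vs \<subseteq> vertices L - S" using p by (auto simp: is_path_def)
next
  fix \<sigma> assume "\<sigma> \<in> L" "set \<sigma> \<subseteq> vertices L - S"
  then show "\<sigma> \<in> delete_vertices L S" by (auto simp: delete_vertices_def)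
qed

end
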